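(* Assume that the analytic function $f(\boldsymbol{x})=\sum_{\boldsymbol{k}\in\mathbb{N}^d}a_{\boldsymbol{k}}\boldsymbol{x}^{\boldsymbol{k}}$ is absolutely convergent in $[-1,1]^d$. Then for any $\varepsilon,\delta>0$, there exists a function $\hat f$ that can be represented by a deep ReLU network with depth $$L=\left[e\left(\frac{1}{d\delta}\log\frac{1}{\varepsilon}+1\right)\right]^{2d}$$ and width $d+4$, such that $|f(\boldsymbol{x})-\hat f(\boldsymbol{x})|<2\varepsilon\sum_{\boldsymbol{k}}|a_{\boldsymbol{k}}|$ for all $\boldsymbol{x}\in[-1+\delta,1-\delta]^d$.
   Context: Here $\mathbb{N}=\{0,1,2,\dots\}$, $\boldsymbol{x}=(x_1,\dots,x_d)$, $\boldsymbol{x}^{\boldsymbol{k}}=x_1^{k_1}\cdots x_d^{k_d}$, the sum $\sum_{\boldsymbol{k}}$ runs over $\boldsymbol{k}\in\mathbb{N}^d$, $\log$ is the natural logarithm, and the square brackets in the formula for $L$ are ordinary grouping brackets. "$f$ is absolutely convergent" means that its power series is. $\mathrm{ReLU}(t)=\max(t,0)$. A ReLU network on $\mathbb{R}^d$ is a standard fully connected feedforward network (connections only between adjacent layers): every node of the first hidden layer is $\mathrm{ReLU}$ of an affine function of the inputs $x_1,\dots,x_d$; every node of each later hidden layer is $\mathrm{ReLU}$ of an affine function of the nodes of the preceding hidden layer; the output is an affine function of the nodes of the last hidden layer. Its width is the number of nodes in each hidden layer. Its depth is its number of layers, with the output layer counted, so that a network with $H$ hidden layers has depth $H+1$.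
   Formalization: Added: some a_k is nonzero (otherwise the strict bound reads |f - f̂| < 0) and L ≥ 2 (automatic for ε ≤ 1; for ε > 1 the formula can give e.g. L = 0, where no network exists); depth L is read as the integer part of L. *)

theory Defs
  imports "HOL-Analysis.Analysis"
begin

definition relu :: "real \<Rightarrow> real" where
  "relu t = max t 0"

text \<open>
  \<open>hidden_layer w n h\<close>: the functions \<open>h 0, \<dots>, h (w - 1)\<close> of the input are the nodes of the
  \<open>n\<close>-th hidden layer (counted from 1) of a fully connected network all of whose hidden layers
  have exactly \<open>w\<close> nodes. The values \<open>h j\<close> with \<open>j \<ge> w\<close> are irrelevant.
\<close>

inductive hidden_layer :: "nat \<Rightarrow> nat \<Rightarrow> (nat \<Rightarrow> real ^ 'd \<Rightarrow> real) \<Rightarrow> bool" for w :: nat where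
  first: "(\<And>j. j < w \<Longrightarrow> \<exists>a b. \<forall>x. h j x = relu (a \<bullet> x + b)) \<Longrightarrow> hidden_layer w 1 h"
| later: "hidden_layer w n g \<Longrightarrow>
          (\<And>j. j < w \<Longrightarrow> \<exists>c b. \<forall>x. h j x = relu ((\<Sum>i<w. c i * g i x) + b)) \<Longrightarrow>
          hidden_layer w (Suc n) h"

text \<open>The depth counts the output layer, so a network with \<open>n\<close> hidden layers has depth \<open>n + 1\<close>;
  since \<open>n \<ge> 1\<close>, no function is represented with depth 0 or 1.\<close>

definition relu_network_function :: "nat \<Rightarrow> nat \<Rightarrow> (real ^ 'd \<Rightarrow> real) \<Rightarrow> bool" where
  "relu_network_function depth width f \<longleftrightarrow>
     (\<exists>n h c b. depth = Suc n \<and> hidden_layer width n h \<and>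
        (\<forall>x. f x = (\<Sum>i<width. c i * h i x) + b))"

definition multi_power :: "real ^ 'd \<Rightarrow> ('d \<Rightarrow> nat) \<Rightarrow> real" where
  "multi_power x k = (\<Prod>i\<in>UNIV. (x $ i) ^ k i)"

text \<open>The depth formula is at least 2, the smallest depth of a network, whenever
  \<open>0 < \<epsilon> \<le> 1\<close>. For \<open>\<epsilon> > 1\<close> its base can be anything, including 0.\<close>

lemma depth_ge_2:
  fixes \<epsilon> \<delta> :: real and d :: nat
  assumes "0 < \<epsilon>" "\<epsilon> \<le> 1" "0 < \<delta>" "0 < d"
  shows "2 \<le> (exp 1 * (1 / (real d * \<delta>) * ln (1 / \<epsilon>) + 1)) ^ (2 * d)"
proof -
  define B where "B = exp 1 * (1 / (real d * \<delta>) * ln (1 / \<epsilon>) + 1)"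
  have "0 \<le> 1 / (real d * \<delta>) * ln (1 / \<epsilon>)"
    using assms by (intro mult_nonneg_nonneg) auto
  then have "exp 1 * 1 \<le> B"
    unfolding B_def by (intro mult_left_mono) auto
  moreover have "2 \<le> exp (1::real)"
    using exp_ge_add_one_self[of 1] by simp
  ultimately have "2 \<le> B" by linarith
  also have "B \<le> B ^ (2 * d)"
    using \<open>2 \<le> B\<close> \<open>0 < d\<close> by (intro self_le_power) auto
  finally show ?thesis unfolding B_def .
qed

end

theory Submission
  imports Defs
begin

text \<open>
  With \<open>P = \<lfloor>log (1 / \<epsilon>) / \<delta>\<rfloor>\<close> the terms of degree above \<open>P\<close> contribute at most
  \<open>\<epsilon>\<close> times the sum of their coefficients on the smaller cube. The remaining monomials are
  computed one after the other by repeated multiplication with an input: along the chain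
  \<open>x\<^sup>q, x\<^sup>q x\<^sub>i, x\<^sup>q x\<^sub>i\<^sup>2, \<dots>\<close> for every \<open>q\<close> with \<open>q i = 0\<close> and degree at most \<open>P\<close>. A
  multiplication consists of two squarings, and a squaring iterates the tent map on
  \<open>[0, 1]\<close>, each iteration reducing the error by the factor 4. Precision \<open>4 ^ -(P + 1)\<close> for each
  of the at most \<open>P\<close> factors suffices because \<open>P exp (P + 1) \<le> 4 ^ (P + 1)\<close> and
  \<open>exp (-(P + 1)) \<le> \<epsilon>\<close>; it costs \<open>4 P + 8\<close> layers per multiplication. There are at most
  \<open>e ^ d (1 + P / d) ^ (d - 1)\<close> chains of \<open>P\<close> multiplications, and their total length is below the
  given depth.
\<close>

section \<open>Functions that are affine in the nodes of a layer\<close>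

definition unit_cube :: "(real ^ 'd) set" where
  "unit_cube = {x. \<forall>i. \<bar>x $ i\<bar> \<le> 1}"

lemma unit_cubeD: "x \<in> unit_cube \<Longrightarrow> \<bar>x $ i\<bar> \<le> 1"
  by (simp add: unit_cube_def)

text \<open>Agreement is asked for on the cube only: a single ReLU node passes a value on unchanged
  after a shift that makes it nonnegative, and the constants for such shifts come from bounds on the
  cube.\<close>

definition affine_in :: "nat \<Rightarrow> (nat \<Rightarrow> real ^ 'd \<Rightarrow> real) \<Rightarrow> (real ^ 'd \<Rightarrow> real) \<Rightarrow> bool" where
  "affine_in w h f \<longleftrightarrow> (\<exists>c b. \<forall>x\<in>unit_cube. f x = (\<Sum>i<w. c i * h i x) + b)"

lemma affine_in_cong:
  assumes "affine_in w h f" "\<And>x. x \<in> unit_cube \<Longrightarrow> g x = f x"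
  shows "affine_in w h g"
  using assms unfolding affine_in_def by auto

lemma affine_in_const: "affine_in w h (\<lambda>x. b)"
  unfolding affine_in_def by (rule exI[of _ "\<lambda>_. 0"]) auto

lemma affine_in_node:
  assumes "j < w"
  shows "affine_in w h (h j)"
proof -
  have "(\<Sum>i<w. (if i = j then 1 else 0) * h i x) = (\<Sum>i<w. if i = j then h i x else 0)" for x
    by (intro sum.cong) auto
  then have "\<forall>x\<in>unit_cube. h j x = (\<Sum>i<w. (if i = j then 1 else 0) * h i x) + 0"
    using assms by simp
  then show ?thesis
    unfolding affine_in_def by (intro exI[of _ "\<lambda>i. if i = j then 1 else 0"] exI[of _ 0])
qed

lemma affine_in_add:
  assumes "affine_in w h f" "affine_in w h g"
  shows "affine_in w h (\<lambda>x. f x + g x)"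
proof -
  obtain c b c' b' where "\<forall>x\<in>unit_cube. f x = (\<Sum>i<w. c i * h i x) + b"
    "\<forall>x\<in>unit_cube. g x = (\<Sum>i<w. c' i * h i x) + b'"
    using assms unfolding affine_in_def by blast
  then have "\<forall>x\<in>unit_cube. f x + g x = (\<Sum>i<w. (c i + c' i) * h i x) + (b + b')"
    by (simp add: algebra_simps sum.distrib)
  then show ?thesis
    unfolding affine_in_def by (intro exI[of _ "\<lambda>i. c i + c' i"] exI[of _ "b + b'"])
qed

lemma affine_in_cmult:
  assumes "affine_in w h f"
  shows "affine_in w h (\<lambda>x. a * f x)"
proof -
  obtain c b where "\<forall>x\<in>unit_cube. f x = (\<Sum>i<w. c i * h i x) + b"
    using assms unfolding affine_in_def by blast
  then have "\<forall>x\<in>unit_cube. a * f x = (\<Sum>i<w. (a * c i) * h i x) + a * b"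
    by (simp add: algebra_simps sum_distrib_left)
  then show ?thesis
    unfolding affine_in_def by (intro exI[of _ "\<lambda>i. a * c i"] exI[of _ "a * b"])
qed

lemma affine_in_diff:
  assumes "affine_in w h f" "affine_in w h g"
  shows "affine_in w h (\<lambda>x. f x - g x)"
  using affine_in_add[OF assms(1) affine_in_cmult[OF assms(2), of "-1"]] by simp

lemma affine_in_minus: "affine_in w h f \<Longrightarrow> affine_in w h (\<lambda>x. - f x)"
  using affine_in_cmult[of w h f "-1"] by simp

lemmas affine_in_intros = affine_in_const affine_in_add affine_in_diff affine_in_minus affine_in_cmult

lemma affine_in_bounded:
  assumes "affine_in w h f" "\<And>j. j < w \<Longrightarrow> bounded (h j ` unit_cube)"
  shows "bounded (f ` unit_cube)"
proof -
  obtain c b where f: "\<And>x. x \<in> unit_cube \<Longrightarrow> f x = (\<Sum>i<w. c i * h i x) + b"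
    using assms(1) unfolding affine_in_def by blast
  have "\<forall>j. \<exists>M. j < w \<longrightarrow> (\<forall>x\<in>unit_cube. \<bar>h j x\<bar> \<le> M)"
    using assms(2) by (force simp: bounded_iff)
  then obtain M where M: "\<And>j x. j < w \<Longrightarrow> x \<in> unit_cube \<Longrightarrow> \<bar>h j x\<bar> \<le> M j"
    by metis
  have "\<bar>f x\<bar> \<le> (\<Sum>i<w. \<bar>c i\<bar> * M i) + \<bar>b\<bar>" if "x \<in> unit_cube" for x
  proof -
    have "\<bar>\<Sum>i<w. c i * h i x\<bar> \<le> (\<Sum>i<w. \<bar>c i * h i x\<bar>)" by (rule sum_abs)
    also have "\<dots> \<le> (\<Sum>i<w. \<bar>c i\<bar> * M i)"
      using M that by (intro sum_mono) (auto simp: abs_mult intro: mult_left_mono)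
    finally show ?thesis using f[OF that] by linarith
  qed
  then show ?thesis unfolding bounded_iff by auto
qed

lemma bounded_relu:
  assumes "bounded (f ` S)"
  shows "bounded ((\<lambda>x. relu (f x)) ` S)"
  proof -
  obtain M where M: "\<And>x. x \<in> S \<Longrightarrow> \<bar>f x\<bar> \<le> M"
    using assms by (auto simp: bounded_iff)
  have "\<bar>relu (f x)\<bar> \<le> M" if "x \<in> S" for x
    using M[OF that] by (auto simp: relu_def max_def)
  then show ?thesis by (auto simp: bounded_iff)
qed

text \<open>Affine maps and ReLU preserve boundedness. The bounds later serve as the shift constants
  for values that are merely passed on.\<close>

lemma hidden_layer_bounded:
  assumes "hidden_layer w n h" "j < w"
  shows "bounded (h j ` unit_cube)"
  using assms
proof (induction arbitrary: j rule: hidden_layer.induct)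
  case (first h)
  then obtain a b where h: "\<And>x. h j x = relu (a \<bullet> x + b)" by blast
  have "\<bar>a \<bullet> x + b\<bar> \<le> (\<Sum>i\<in>UNIV. \<bar>a $ i\<bar>) + \<bar>b\<bar>" if "x \<in> unit_cube" for x
  proof -
    have "\<bar>a \<bullet> x\<bar> \<le> (\<Sum>i\<in>UNIV. \<bar>a $ i * x $ i\<bar>)" unfolding inner_vec_def inner_real_def by (rule sum_abs)
    also have "\<dots> \<le> (\<Sum>i\<in>UNIV. \<bar>a $ i\<bar>)"
      using that by (intro sum_mono) (auto simp: abs_mult unit_cube_def intro: mult_left_le)
    finally show ?thesis by linarith
  qed
  then have "bounded ((\<lambda>x. a \<bullet> x + b) ` unit_cube)" unfolding bounded_iff by auto
  from bounded_relu[OF this] show ?case using h by simp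
next
  case (later n g h)
  then obtain c b where h: "\<And>x. h j x = relu ((\<Sum>i<w. c i * g i x) + b)" by blast
  have "affine_in w g (\<lambda>x. (\<Sum>i<w. c i * g i x) + b)" unfolding affine_in_def by blast
  from bounded_relu[OF affine_in_bounded[OF this later.IH]] show ?case using h by simp
qed

text \<open>A layer can thus be prescribed by the arguments of its ReLUs, known on the cube only;
  the chosen coefficients extend it to the whole space.\<close>

lemma ex_next_layer:
  assumes "hidden_layer w n h" "\<And>j. j < w \<Longrightarrow> affine_in w h (s j)"
  shows "\<exists>h'. hidden_layer w (Suc n) h' \<and> (\<forall>j<w. \<forall>x\<in>unit_cube. h' j x = relu (s j x))"
proof -
  have "\<forall>j. \<exists>c b. j < w \<longrightarrow> (\<forall>x\<in>unit_cube. s j x = (\<Sum>i<w. c i * h i x) + b)"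
    using assms(2) unfolding affine_in_def by blast
  then obtain c b where cb: "\<And>j x. j < w \<Longrightarrow> x \<in> unit_cube \<Longrightarrow> s j x = (\<Sum>i<w. c j i * h i x) + b j"
    by metis
  define h' where "h' = (\<lambda>j x. relu ((\<Sum>i<w. c j i * h i x) + b j))"
  have "hidden_layer w (Suc n) h'"
    by (rule hidden_layer.later[OF assms(1)]) (auto simp: h'_def)
  moreover have "\<forall>j<w. \<forall>x\<in>unit_cube. h' j x = relu (s j x)"
    using cb by (auto simp: h'_def)
  ultimately show ?thesis by blast
qed

section \<open>Layers that keep the inputs and carry further values\<close>

text \<open>Only adjacent layers are connected, so the inputs must be recoverable from every layer
  to be available for later multiplications.\<close>

definition input_layer :: "nat \<Rightarrow> (nat \<Rightarrow> real ^ 'd \<Rightarrow> real) \<Rightarrow> bool" where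
  "input_layer n h \<longleftrightarrow> hidden_layer (CARD('d) + 4) n h \<and>
     (\<forall>i. affine_in (CARD('d) + 4) h (\<lambda>x. x $ i))"

lemma affine_in_relu_shift:
  assumes "affine_in w h (\<lambda>x. relu (f x + M))" "\<And>x. x \<in> unit_cube \<Longrightarrow> - M \<le> f x"
  shows "affine_in w h f"
proof (rule affine_in_cong)
  show "affine_in w h (\<lambda>x. relu (f x + M) - M)" by (intro affine_in_diff affine_in_const assms(1))
  show "f x = relu (f x + M) - M" if "x \<in> unit_cube" for x
    using assms(2)[OF that] by (simp add: relu_def)
qed

lemma ex_first_input_layer: "\<exists>h :: nat \<Rightarrow> real ^ 'd \<Rightarrow> real. input_layer 1 h"
proof -
  obtain e where e: "bij_betw e {0..<CARD('d)} (UNIV :: 'd set)"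
    using ex_bij_betw_nat_finite[of "UNIV :: 'd set"] by auto
  \<comment> \<open>Beyond the enumeration \<open>e j\<close> is an arbitrary coordinate; the four
    surplus nodes carry nothing.\<close>
  define h :: "nat \<Rightarrow> real ^ 'd \<Rightarrow> real" where "h = (\<lambda>j x. relu (axis (e j) 1 \<bullet> x + 1))"
  have "hidden_layer (CARD('d) + 4) 1 h"
    by (rule hidden_layer.first) (auto simp: h_def)
  moreover have "affine_in (CARD('d) + 4) h (\<lambda>x. x $ i)" for i
  proof -
    obtain j where j: "j < CARD('d)" "e j = i" using e unfolding bij_betw_def
      by (metis UNIV_I atLeastLessThan_iff imageE)
    have "affine_in (CARD('d) + 4) h (h j)" using j by (intro affine_in_node) auto
    moreover have "h j = (\<lambda>x. relu (x $ i + 1))" using j by (simp add: h_def inner_axis')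
    ultimately have "affine_in (CARD('d) + 4) h (\<lambda>x. relu (x $ i + 1))" by simp
    then show ?thesis
    proof (rule affine_in_relu_shift)
      show "- 1 \<le> x $ i" if "x \<in> unit_cube" for x
        using unit_cubeD[OF that, of i] by linarith
    qed
  qed
  ultimately show ?thesis unfolding input_layer_def by blast
qed

text \<open>The width is used up by \<open>d\<close> nodes for the inputs, two for \<open>p\<close> and \<open>q\<close>, which are merely
  passed on, and two for the nonlinear \<open>relu u\<close> and \<open>relu v\<close>. A bounded function passes through
  a single node after adding a constant that makes it nonnegative.\<close>

lemma ex_next_input_layer:
  fixes h :: "nat \<Rightarrow> real ^ 'd \<Rightarrow> real"
  defines "w \<equiv> CARD('d) + 4"
  assumes h: "input_layer n h"
    and p: "affine_in w h p" and q: "affine_in w h q" and u: "affine_in w h u" and v: "affine_in w h v"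
  shows "\<exists>h'. input_layer (Suc n) h' \<and> affine_in w h' p \<and> affine_in w h' q \<and>
    affine_in w h' (\<lambda>x. relu (u x)) \<and> affine_in w h' (\<lambda>x. relu (v x))"
proof -
  obtain e where e: "bij_betw e {0..<CARD('d)} (UNIV :: 'd set)"
    using ex_bij_betw_nat_finite[of "UNIV :: 'd set"] by auto
  have lay: "hidden_layer w n h" and crd: "\<And>i. affine_in w h (\<lambda>x. x $ i)"
    using h unfolding input_layer_def w_def by auto
  obtain P where P: "\<And>x. x \<in> unit_cube \<Longrightarrow> \<bar>p x\<bar> \<le> P"
    using affine_in_bounded[OF p hidden_layer_bounded[OF lay]] by (auto simp: bounded_iff)
  obtain Q where Q: "\<And>x. x \<in> unit_cube \<Longrightarrow> \<bar>q x\<bar> \<le> Q"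
    using affine_in_bounded[OF q hidden_layer_bounded[OF lay]] by (auto simp: bounded_iff)
  define s where "s = (\<lambda>j x. if j < CARD('d) then x $ e j + 1
    else if j = CARD('d) then p x + P else if j = CARD('d) + 1 then q x + Q
    else if j = CARD('d) + 2 then u x else v x)"
  have "affine_in w h (s j)" for j
  proof -
    consider "j < CARD('d)" | "j = CARD('d)" | "j = CARD('d) + 1" | "j = CARD('d) + 2" | "j > CARD('d) + 2"
      by linarith
    then show ?thesis
      by cases (use p q u v crd in \<open>auto simp: s_def intro!: affine_in_intros\<close>)
  qed
  then obtain h' where h': "hidden_layer w (Suc n) h'"
    and val: "\<forall>j<w. \<forall>x\<in>unit_cube. h' j x = relu (s j x)"
    using ex_next_layer[OF lay, of s] by meson
  have node: "affine_in w h' (\<lambda>x. relu (s j x))" if "j < w" for j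
    by (rule affine_in_cong[OF affine_in_node[OF that]]) (use val that in simp)
  have "affine_in w h' (\<lambda>x. x $ i)" for i
  proof -
    obtain j where j: "j < CARD('d)" "e j = i" using e unfolding bij_betw_def
      by (metis UNIV_I atLeastLessThan_iff imageE)
    show ?thesis
    proof (rule affine_in_relu_shift)
      show "affine_in w h' (\<lambda>x. relu (x $ i + 1))"
        using node[of j] j by (simp add: s_def w_def)
      show "- 1 \<le> x $ i" if "x \<in> unit_cube" for x
        using unit_cubeD[OF that, of i] by linarith
    qed
  qed
  moreover have "affine_in w h' p"
  proof (rule affine_in_relu_shift)
    show "affine_in w h' (\<lambda>x. relu (p x + P))"
      using node[of "CARD('d)"] by (simp add: s_def w_def)
    show "- P \<le> p x" if "x \<in> unit_cube" for x
      using P[OF that] by linarith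
  qed
  moreover have "affine_in w h' q"
  proof (rule affine_in_relu_shift)
    show "affine_in w h' (\<lambda>x. relu (q x + Q))"
      using node[of "CARD('d) + 1"] by (simp add: s_def w_def)
    show "- Q \<le> q x" if "x \<in> unit_cube" for x
      using Q[OF that] by linarith
  qed
  moreover have "affine_in w h' (\<lambda>x. relu (u x))" "affine_in w h' (\<lambda>x. relu (v x))"
    using node[of "CARD('d) + 2"] node[of "CARD('d) + 3"] by (auto simp: s_def w_def)
  ultimately show ?thesis using h' unfolding input_layer_def w_def by blast
qed

text \<open>Idle layers fill the gap between the depth that the construction uses and the exact
  depth that is prescribed.\<close>

lemma ex_input_layer_pad:
  fixes h :: "nat \<Rightarrow> real ^ 'd \<Rightarrow> real"
  assumes "input_layer n h" "affine_in (CARD('d) + 4) h p" "n \<le> n'"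
  shows "\<exists>h'. input_layer n' h' \<and> affine_in (CARD('d) + 4) h' p"
  using assms(3)
proof (induction n' rule: dec_induct)
  case base
  then show ?case using assms by blast
next
  case (step n')
  then show ?case using ex_next_input_layer by blast
qed

section \<open>Approximate squaring and multiplication\<close>

text \<open>Let t_0 = |u| and let t_(k+1) be the tent map of t_k. Then t_0 minus the sum of t_k /
  4^k over k = 1..m approximates u^2 from above. One node accumulates \<open>q\<close> plus \<kappa>
  times this expression and the two nonlinear nodes produce the next iterate, so \<open>p\<close>
  keeps a node of its own.\<close>

lemma ex_square_layers:
  fixes h :: "nat \<Rightarrow> real ^ 'd \<Rightarrow> real" and \<kappa> :: real
  defines "w \<equiv> CARD('d) + 4"
  assumes h: "input_layer n h"
    and p: "affine_in w h p" and q: "affine_in w h q" and u: "affine_in w h u"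
    and bound: "\<forall>x\<in>unit_cube. \<bar>u x\<bar> \<le> 1"
  shows "\<exists>h' r. input_layer (n + Suc m) h' \<and> affine_in w h' p \<and>
    affine_in w h' (\<lambda>x. q x + \<kappa> * ((u x)\<^sup>2 + r x)) \<and>
    (\<forall>x\<in>unit_cube. 0 \<le> r x \<and> r x \<le> (1 / 4) ^ Suc m)"
proof -
  \<comment> \<open>Here \<open>g\<close> is the current tent iterate. The remainder is stated
    exactly, so that each new layer only subtracts one multiple of the next iterate from the
    accumulated value.\<close>
  have "\<exists>h' g. input_layer (n + Suc m) h' \<and> affine_in w h' p \<and>
    affine_in w h' (\<lambda>x. q x + \<kappa> * ((u x)\<^sup>2 + (1 / 4) ^ m * (g x - (g x)\<^sup>2))) \<and>
    affine_in w h' g \<and> (\<forall>x\<in>unit_cube. 0 \<le> g x \<and> g x \<le> 1)"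
  proof (induction m)
    case 0
    obtain h' where h': "input_layer (Suc n) h'" "affine_in w h' p" "affine_in w h' q"
      "affine_in w h' (\<lambda>x. relu (u x))" "affine_in w h' (\<lambda>x. relu (- u x))"
      using ex_next_input_layer[OF h, folded w_def, OF p q u affine_in_minus[OF u]] by blast
    have eq: "\<bar>t\<bar> = relu t + relu (- t)" for t by (simp add: relu_def)
    have abs: "affine_in w h' (\<lambda>x. \<bar>u x\<bar>)"
      unfolding eq using h' by (intro affine_in_intros)
    \<comment> \<open>The squares cancel: the accumulated value starts as
      \<open>q x + \<kappa> * \<bar>u x\<bar>\<close>.\<close>
    then have "affine_in w h' (\<lambda>x. q x + \<kappa> * ((u x)\<^sup>2 + (1 / 4) ^ 0 * (\<bar>u x\<bar> - \<bar>u x\<bar>\<^sup>2)))"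
      using h' by (simp add: affine_in_intros)
    then show ?case using h' abs bound by (intro exI[of _ h'] exI[of _ "\<lambda>x. \<bar>u x\<bar>"]) auto
  next
    case (Suc m)
    define Q where "Q = (\<lambda>g x. q x + \<kappa> * ((u x)\<^sup>2 + (1 / 4) ^ m * (g x - (g x)\<^sup>2)))"
    from Suc obtain h1 g where h1: "input_layer (n + Suc m) h1" "affine_in w h1 p"
      "affine_in w h1 (Q g)" "affine_in w h1 g"
      and g: "\<And>x. x \<in> unit_cube \<Longrightarrow> 0 \<le> g x \<and> g x \<le> 1" unfolding Q_def by blast
    \<comment> \<open>As \<open>g\<close> is nonnegative, \<open>relu (g x)\<close> carries it
      unchanged; the other nonlinear node supplies the kink of the tent map at 1/2.\<close>
    have "affine_in w h1 (\<lambda>x. g x - 1 / 2)" using h1 by (intro affine_in_intros)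
    from ex_next_input_layer[OF h1(1), folded w_def, OF h1(2,3,4) this]
    obtain h' where h': "input_layer (Suc (n + Suc m)) h'" "affine_in w h' p" "affine_in w h' (Q g)"
      "affine_in w h' (\<lambda>x. relu (g x))" "affine_in w h' (\<lambda>x. relu (g x - 1 / 2))" by blast
    \<comment> \<open>For the tent map \<open>t \<mapsto> t'\<close> on \<open>[0, 1]\<close> one has \<open>(t' - t'\<^sup>2) / 4 = t - t\<^sup>2 - t' / 4\<close>.\<close>
    define g' where "g' = (\<lambda>x. 2 * relu (g x) - 4 * relu (g x - 1 / 2))"
    have g'_aff: "affine_in w h' g'"
      unfolding g'_def using h' by (intro affine_in_intros)
    have g'_bd: "0 \<le> g' x \<and> g' x \<le> 1" if "x \<in> unit_cube" for x
      using g[OF that] by (auto simp: g'_def relu_def max_def)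
    have tent: "(g' x - (g' x)\<^sup>2) / 4 = g x - (g x)\<^sup>2 - g' x / 4" if x: "x \<in> unit_cube" for x
    proof -
      have "g' x = (if g x \<le> 1 / 2 then 2 * g x else 2 - 2 * g x)"
        using g[OF x] by (simp add: g'_def relu_def)
      then show ?thesis by (simp add: power2_eq_square field_simps)
    qed
    have "affine_in w h' (\<lambda>x. Q g x - \<kappa> * ((1 / 4) ^ Suc m * g' x))"
      using h' g'_aff by (intro affine_in_intros)
    then have "affine_in w h' (\<lambda>x. q x + \<kappa> * ((u x)\<^sup>2 + (1 / 4) ^ Suc m * (g' x - (g' x)\<^sup>2)))"
    proof (rule affine_in_cong)
      fix x :: "real ^ 'd" assume x: "x \<in> unit_cube"
      have "(1 / 4) ^ Suc m * (g' x - (g' x)\<^sup>2) = (1 / 4) ^ m * ((g' x - (g' x)\<^sup>2) / 4)" by simp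
      also have "\<dots> = (1 / 4) ^ m * (g x - (g x)\<^sup>2) - (1 / 4) ^ Suc m * g' x"
        unfolding tent[OF x] by (simp add: algebra_simps)
      finally have *: "(1 / 4) ^ Suc m * (g' x - (g' x)\<^sup>2) = \<dots>" .
      show "q x + \<kappa> * ((u x)\<^sup>2 + (1 / 4) ^ Suc m * (g' x - (g' x)\<^sup>2))
          = Q g x - \<kappa> * ((1 / 4) ^ Suc m * g' x)"
        unfolding * Q_def by (simp only: algebra_simps)
    qed
    then show ?case using h' g'_aff g'_bd by (intro exI[of _ h'] exI[of _ g']) auto
  qed
  then obtain h' g where h': "input_layer (n + Suc m) h'" "affine_in w h' p"
    "affine_in w h' (\<lambda>x. q x + \<kappa> * ((u x)\<^sup>2 + (1 / 4) ^ m * (g x - (g x)\<^sup>2)))"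
    and g: "\<And>x. x \<in> unit_cube \<Longrightarrow> 0 \<le> g x \<and> g x \<le> 1" by blast
  have "0 \<le> (1 / 4) ^ m * (g x - (g x)\<^sup>2) \<and> (1 / 4) ^ m * (g x - (g x)\<^sup>2) \<le> (1 / 4) ^ Suc m"
    if "x \<in> unit_cube" for x
  proof -
    have "g x - (g x)\<^sup>2 = g x * (1 - g x)" by (simp add: power2_eq_square algebra_simps)
    then have "0 \<le> g x - (g x)\<^sup>2" using g[OF that] by simp
    moreover have "g x - (g x)\<^sup>2 \<le> 1 / 4"
      using zero_le_power2[of "g x - 1 / 2"] by (simp add: power2_eq_square algebra_simps)
    ultimately show ?thesis by (simp add: mult_left_mono)
  qed
  with h' show ?thesis
    by (intro exI[of _ h'] exI[of _ "\<lambda>x. (1 / 4) ^ m * (g x - (g x)\<^sup>2)"]) blast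
qed

text \<open>The obvious identity \<open>4 x y = (x + y)\<^sup>2 - (x - y)\<^sup>2\<close> would have to store \<open>y\<close> while the first
  square is computed, which takes one node too many. The difference quotient
  \<open>((x + c y)\<^sup>2 - x\<^sup>2) / (2 c)\<close> with small \<open>c\<close> approximates \<open>x y\<close> and its second square only
  involves an input.\<close>

lemma ex_mult_layers:
  fixes h :: "nat \<Rightarrow> real ^ 'd \<Rightarrow> real" and i :: 'd
  defines "w \<equiv> CARD('d) + 4"
  assumes h: "input_layer n h"
    and p: "affine_in w h p" and y: "affine_in w h y"
    and bound: "\<forall>x\<in>unit_cube. \<bar>y x\<bar> \<le> 2"
  shows "\<exists>h' z. input_layer (n + 2 * Suc m) h' \<and> affine_in w h' p \<and> affine_in w h' z \<and>
    (\<forall>x\<in>unit_cube. \<bar>z x - x $ i * y x\<bar> \<le> 4 * (1 / 2) ^ Suc m)"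
proof -
  \<comment> \<open>This choice balances two errors: the difference quotient is off by order
    \<open>c\<close>, and the squaring error \<open>c^2\<close> gets divided by
    \<open>c\<close>.\<close>
  define c :: real where "c = (1 / 2) ^ Suc m"
  have c: "0 < c" "c \<le> 1 / 2" by (auto simp: c_def power_le_one)
  have c2: "(1 / 4) ^ Suc m = c\<^sup>2"
  proof -
    have "c\<^sup>2 = ((1 / 2)\<^sup>2) ^ Suc m" unfolding c_def by (simp only: power_mult[symmetric] mult.commute)
    then show ?thesis by (simp add: power2_eq_square)
  qed
  have crd: "affine_in w h (\<lambda>x. x $ i)"
    if "input_layer n h" for n and h :: "nat \<Rightarrow> real ^ 'd \<Rightarrow> real"
    using that unfolding input_layer_def w_def by blast
  \<comment> \<open>The factor 1/2 keeps the argument of the square in [-1, 1]. It is compensated by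
    \<open>\<kappa> = 2 / c\<close>, as \<open>2 / c * u^2\<close> equals (x_i + c y)^2 / (2
    c).\<close>
  define u where "u = (\<lambda>x. (1 / 2) * (x $ i + c * y x))"
  have u: "affine_in w h u"
    unfolding u_def using crd[OF h] y by (intro affine_in_intros)
  have "\<bar>u x\<bar> \<le> 1" if "x \<in> unit_cube" for x
  proof -
    have "\<bar>c * y x\<bar> \<le> (1 / 2) * 2"
      unfolding abs_mult using c bspec[OF bound that] by (intro mult_mono) auto
    then have "\<bar>x $ i + c * y x\<bar> \<le> 2" using unit_cubeD[OF that, of i] by linarith
    then show ?thesis by (simp add: u_def)
  qed
  then have "\<forall>x\<in>unit_cube. \<bar>u x\<bar> \<le> 1" by blast
  from ex_square_layers[OF h, folded w_def, OF p affine_in_const[of _ _ 0] u this,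
      where \<kappa> = "2 / c" and m = m]
  obtain h1 r1 where h1: "input_layer (n + Suc m) h1" "affine_in w h1 p"
    "affine_in w h1 (\<lambda>x. 0 + 2 / c * ((u x)\<^sup>2 + r1 x))"
    and r1: "\<And>x. x \<in> unit_cube \<Longrightarrow> 0 \<le> r1 x \<and> r1 x \<le> c\<^sup>2" unfolding c2 by blast
  have "\<forall>x\<in>unit_cube. \<bar>x $ i\<bar> \<le> 1" using unit_cubeD by blast
  \<comment> \<open>The first quotient enters as the value to accumulate on, so the second one is
    subtracted from it in place and \<open>y\<close> need not be kept.\<close>
  from ex_square_layers[OF h1(1), folded w_def, OF h1(2,3) crd[OF h1(1)] this,
      where \<kappa> = "- (1 / (2 * c))" and m = m]
  obtain h' r2 where h': "input_layer (n + Suc m + Suc m) h'" "affine_in w h' p"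
    "affine_in w h' (\<lambda>x. 0 + 2 / c * ((u x)\<^sup>2 + r1 x) + - (1 / (2 * c)) * ((x $ i)\<^sup>2 + r2 x))"
    and r2: "\<And>x. x \<in> unit_cube \<Longrightarrow> 0 \<le> r2 x \<and> r2 x \<le> c\<^sup>2" unfolding c2 by blast
  define z where
    "z = (\<lambda>x. 0 + 2 / c * ((u x)\<^sup>2 + r1 x) + - (1 / (2 * c)) * ((x $ i)\<^sup>2 + r2 x))"
  have "\<bar>z x - x $ i * y x\<bar> \<le> 4 * c" if x: "x \<in> unit_cube" for x
  proof -
    \<comment> \<open>\<open>a\<close> is the error of the exact difference quotient,
      \<open>b\<close> and \<open>d\<close> are the rescaled errors of the two squarings.\<close>
    define a b d where abd: "a = c * (y x)\<^sup>2 / 2" "b = r1 x / c" "d = r2 x / c"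
    have eq: "z x - x $ i * y x = a + 2 * b - d / 2"
      using c unfolding abd z_def u_def by (simp add: field_simps power2_eq_square)
    have "(y x)\<^sup>2 \<le> 2\<^sup>2" using bspec[OF bound x] by (metis abs_ge_zero power2_abs power_mono)
    then have "a \<le> 2 * c" "0 \<le> a"
      using c by (auto simp: abd mult_left_mono)
    moreover have "0 \<le> b" "b \<le> c" "0 \<le> d" "d \<le> c"
      using r1[OF x] r2[OF x] c unfolding abd by (auto simp: field_simps power2_eq_square)
    ultimately show ?thesis unfolding eq using c by linarith
  qed
  then have "\<forall>x\<in>unit_cube. \<bar>z x - x $ i * y x\<bar> \<le> 4 * c" by blast
  moreover have "input_layer (n + 2 * Suc m) h'" using h'(1) by (simp add: mult_2 add.assoc)
  moreover have "affine_in w h' z" using h'(3) unfolding z_def .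
  ultimately show ?thesis using h'(2) unfolding c_def by blast
qed

section \<open>Monomials and chains of monomials\<close>

lemma multi_power_Suc:
  "multi_power x (q(i := Suc (q i))) = x $ i * multi_power x q"
proof -
  have "multi_power x (q(i := Suc (q i))) = (\<Prod>j\<in>UNIV. (if j = i then x $ i else 1) * (x $ j) ^ q j)"
    unfolding multi_power_def by (intro prod.cong) auto
  then show ?thesis by (simp add: prod.distrib multi_power_def)
qed

lemma abs_multi_power_le:
  assumes "\<And>i. \<bar>x $ i\<bar> \<le> \<rho>"
  shows "\<bar>multi_power x q\<bar> \<le> \<rho> ^ sum q UNIV"
  unfolding multi_power_def abs_prod power_abs power_sum
  using assms by (intro prod_mono) (auto intro: power_mono)

lemma abs_multi_power_le_1:
  assumes "x \<in> unit_cube"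
  shows "\<bar>multi_power x q\<bar> \<le> 1"
  using abs_multi_power_le[of x 1 q] unit_cubeD[OF assms] by simp

lemma sum_fun_upd:
  fixes q :: "'d::finite \<Rightarrow> nat"
  shows "sum (q(i := j)) UNIV + q i = sum q UNIV + j"
proof -
  have "sum (q(i := j)) UNIV = j + sum (q(i := j)) (UNIV - {i})"
    using sum.remove[of UNIV i "q(i := j)"] by simp
  moreover have "sum (q(i := j)) (UNIV - {i}) = sum q (UNIV - {i})"
    by (intro sum.cong) auto
  moreover have "sum q UNIV = q i + sum q (UNIV - {i})"
    using sum.remove[of UNIV i q] by simp
  ultimately show ?thesis by simp
qed

text \<open>A factor of modulus at most 1 does not enlarge the old error, so errors merely add up.
  The assumption \<open>small\<close> keeps \<open>y\<close> within the bound 2 that the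
  multiplication demands.\<close>

lemma ex_mult_monomial:
  fixes h :: "nat \<Rightarrow> real ^ 'd \<Rightarrow> real" and i :: 'd and m :: nat
  defines "w \<equiv> CARD('d) + 4" and "\<eta> \<equiv> 4 * (1 / 2) ^ Suc m"
  assumes h: "input_layer n h"
    and p: "affine_in w h p" and y: "affine_in w h y"
    and y_near: "\<forall>x\<in>unit_cube. \<bar>y x - multi_power x q\<bar> \<le> real r * \<eta>"
    and small: "real r * \<eta> \<le> 1"
  shows "\<exists>h' z. input_layer (n + 2 * Suc m) h' \<and> affine_in w h' p \<and> affine_in w h' z \<and>
    (\<forall>x\<in>unit_cube. \<bar>z x - multi_power x (q(i := Suc (q i)))\<bar> \<le> real (Suc r) * \<eta>)"
proof -
  have "\<bar>y x\<bar> \<le> 2" if "x \<in> unit_cube" for x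
    using bspec[OF y_near that] small abs_multi_power_le_1[OF that, of q] by linarith
  then have "\<forall>x\<in>unit_cube. \<bar>y x\<bar> \<le> 2" by blast
  from ex_mult_layers[OF h, folded w_def, OF p y this, where i = i and m = m]
  obtain h' z where h': "input_layer (n + 2 * Suc m) h'" "affine_in w h' p" "affine_in w h' z"
    and z: "\<And>x. x \<in> unit_cube \<Longrightarrow> \<bar>z x - x $ i * y x\<bar> \<le> \<eta>" unfolding \<eta>_def by blast
  have "\<bar>z x - multi_power x (q(i := Suc (q i)))\<bar> \<le> real (Suc r) * \<eta>" if x: "x \<in> unit_cube" for x
  proof -
    have "\<bar>x $ i * (y x - multi_power x q)\<bar> \<le> 1 * (real r * \<eta>)"
      unfolding abs_mult using unit_cubeD[OF x, of i] bspec[OF y_near x] by (intro mult_mono) auto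
    then have "\<bar>x $ i * y x - x $ i * multi_power x q\<bar> \<le> real r * \<eta>"
      by (simp add: right_diff_distrib)
    then show ?thesis unfolding multi_power_Suc using z[OF x] by (simp add: distrib_right)
  qed
  then show ?thesis using h' by blast
qed

text \<open>Starting from the constant 1, one input at a time is multiplied in. This computes the
  head of a chain.\<close>

lemma ex_monomial_layers:
  fixes h :: "nat \<Rightarrow> real ^ 'd \<Rightarrow> real" and m :: nat and q :: "'d \<Rightarrow> nat"
  defines "w \<equiv> CARD('d) + 4" and "\<eta> \<equiv> 4 * (1 / 2) ^ Suc m"
  assumes h: "input_layer n h" and p: "affine_in w h p"
    and "sum q UNIV = r" "real r * \<eta> \<le> 1"
  shows "\<exists>h' y. input_layer (n + r * (2 * Suc m)) h' \<and> affine_in w h' p \<and> affine_in w h' y \<and>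
    (\<forall>x\<in>unit_cube. \<bar>y x - multi_power x q\<bar> \<le> real r * \<eta>)"
  using assms(5,6)
proof (induction r arbitrary: q)
  case 0
  then have "q = (\<lambda>_. 0)" by auto
  then have "multi_power x q = 1" for x by (simp add: multi_power_def)
  then show ?case using h p affine_in_const[of w h 1]
    by (intro exI[of _ h] exI[of _ "\<lambda>_. 1"]) auto
next
  case (Suc r)
  then obtain i where "q i \<noteq> 0" by (metis nat.distinct(1) sum.not_neutral_contains_not_neutral)
  then obtain k where k: "q i = Suc k" using not0_implies_Suc by blast
  define q' where "q' = q(i := k)"
  have q: "q = q'(i := Suc (q' i))" using k by (auto simp: q'_def)
  have r: "sum q' UNIV = r" using sum_fun_upd[of q i k] k Suc.prems(1) by (simp add: q'_def)
  have "real r * \<eta> \<le> real (Suc r) * \<eta>" unfolding \<eta>_def by (intro mult_right_mono) auto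
  then have small: "real r * \<eta> \<le> 1" using Suc.prems(2) by linarith
  obtain h1 y where h1: "input_layer (n + r * (2 * Suc m)) h1" "affine_in w h1 p" "affine_in w h1 y"
    and y: "\<forall>x\<in>unit_cube. \<bar>y x - multi_power x q'\<bar> \<le> real r * \<eta>"
    using Suc.IH[OF r small] by blast
  from ex_mult_monomial[OF h1(1), folded w_def, OF h1(2,3), of q' r m i, folded \<eta>_def, OF y small, folded q]
  obtain h' z where h': "input_layer (n + r * (2 * Suc m) + 2 * Suc m) h'" "affine_in w h' p"
    "affine_in w h' z" "\<forall>x\<in>unit_cube. \<bar>z x - multi_power x q\<bar> \<le> real (Suc r) * \<eta>" by blast
  have "n + r * (2 * Suc m) + 2 * Suc m = n + Suc r * (2 * Suc m)" by simp
  from h'[unfolded this] show ?case by blast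
qed

text \<open>Each monomial from the head on is added to the running sum as soon as it is available.
  This costs no layer, since sum and monomial are both affine in the same nodes. The last monomial
  \<open>y\<close> is exposed because the next multiplication starts from it.\<close>

lemma ex_chain_layers:
  fixes h :: "nat \<Rightarrow> real ^ 'd \<Rightarrow> real" and m :: nat and i :: 'd
  defines "w \<equiv> CARD('d) + 4" and "\<eta> \<equiv> 4 * (1 / 2) ^ Suc m"
  assumes h: "input_layer n h" and p: "affine_in w h p"
    and q: "q i = 0" "sum q UNIV + j \<le> P" and small: "real P * \<eta> \<le> 1"
  shows "\<exists>h' p' y. input_layer (n + (sum q UNIV + j) * (2 * Suc m)) h' \<and>
    affine_in w h' p' \<and> affine_in w h' y \<and>
    (\<forall>x\<in>unit_cube. \<bar>y x - multi_power x (q(i := j))\<bar> \<le> real (sum q UNIV + j) * \<eta>) \<and>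
    (\<forall>x\<in>unit_cube. \<bar>p' x - p x - (\<Sum>l\<le>j. a (q(i := l)) * multi_power x (q(i := l)))\<bar>
        \<le> (\<Sum>l\<le>j. \<bar>a (q(i := l))\<bar>) * (real P * \<eta>))"
  using q(2)
proof (induction j)
  case 0
  define r where "r = sum q UNIV"
  have "real r * \<eta> \<le> real P * \<eta>"
    using 0 unfolding \<eta>_def r_def by (intro mult_right_mono of_nat_mono) auto
  note r = this order_trans[OF this small]
  have q0: "q(i := 0) = q" using q by auto
  from ex_monomial_layers[OF h, folded w_def, OF p r_def[symmetric], of m, folded \<eta>_def, OF r(2)]
  obtain h' y where h': "input_layer (n + r * (2 * Suc m)) h'" "affine_in w h' p" "affine_in w h' y"
    and y: "\<forall>x\<in>unit_cube. \<bar>y x - multi_power x q\<bar> \<le> real r * \<eta>" by blast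
  have "affine_in w h' (\<lambda>x. p x + a q * y x)" using h' by (intro affine_in_intros)
  moreover have "\<bar>(p x + a q * y x) - p x - a q * multi_power x q\<bar> \<le> \<bar>a q\<bar> * (real P * \<eta>)"
    if "x \<in> unit_cube" for x
  proof -
    have "\<bar>a q * (y x - multi_power x q)\<bar> \<le> \<bar>a q\<bar> * (real P * \<eta>)"
      unfolding abs_mult using order_trans[OF bspec[OF y that] r(1)] by (intro mult_left_mono) auto
    then show ?thesis by (simp add: right_diff_distrib)
  qed
  ultimately show ?case using h' y
    by - (rule exI[of _ h'], rule exI[of _ "\<lambda>x. p x + a q * y x"], rule exI[of _ y],
      simp add: q0 r_def)
next
  case (Suc j)
  define r where "r = sum q UNIV + j"
  define S where "S = (\<lambda>x. \<Sum>l\<le>j. a (q(i := l)) * multi_power x (q(i := l)))"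
  define B where "B = (\<Sum>l\<le>j. \<bar>a (q(i := l))\<bar>)"
  define q' where "q' = q(i := Suc j)"
  have r: "real r * \<eta> \<le> 1" "real (Suc r) * \<eta> \<le> real P * \<eta>"
  proof -
    show "real (Suc r) * \<eta> \<le> real P * \<eta>"
      using Suc.prems unfolding \<eta>_def r_def by (intro mult_right_mono of_nat_mono) auto
    moreover have "real r * \<eta> \<le> real (Suc r) * \<eta>"
      unfolding \<eta>_def by (intro mult_right_mono) auto
    ultimately show "real r * \<eta> \<le> 1" using small by linarith
  qed
  have "sum q UNIV + j \<le> P" using Suc.prems by simp
  from Suc.IH[OF this] obtain h1 p1 y1 where h1: "input_layer (n + r * (2 * Suc m)) h1"
    "affine_in w h1 p1" "affine_in w h1 y1"
    and y1: "\<forall>x\<in>unit_cube. \<bar>y1 x - multi_power x (q(i := j))\<bar> \<le> real r * \<eta>"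
    and p1: "\<forall>x\<in>unit_cube. \<bar>p1 x - p x - S x\<bar> \<le> B * (real P * \<eta>)"
    unfolding r_def S_def B_def by blast
  from ex_mult_monomial[OF h1(1), folded w_def, OF h1(2,3), of "q(i := j)" r m i, folded \<eta>_def, OF y1 r(1)]
  obtain h' z where h': "input_layer (n + r * (2 * Suc m) + 2 * Suc m) h'" "affine_in w h' p1"
    "affine_in w h' z"
    and z: "\<forall>x\<in>unit_cube. \<bar>z x - multi_power x q'\<bar> \<le> real (Suc r) * \<eta>"
    unfolding q'_def by auto
  define p' where "p' = (\<lambda>x. p1 x + a q' * z x)"
  have "\<bar>p' x - p x - (S x + a q' * multi_power x q')\<bar> \<le> (B + \<bar>a q'\<bar>) * (real P * \<eta>)"
    if "x \<in> unit_cube" for x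
  proof -
    have "\<bar>a q' * (z x - multi_power x q')\<bar> \<le> \<bar>a q'\<bar> * (real P * \<eta>)"
      unfolding abs_mult using order_trans[OF bspec[OF z that] r(2)] by (intro mult_left_mono) auto
    then have "\<bar>a q' * z x - a q' * multi_power x q'\<bar> \<le> \<bar>a q'\<bar> * (real P * \<eta>)"
      by (simp add: right_diff_distrib)
    then show ?thesis
      using bspec[OF p1 that] unfolding p'_def distrib_right[of B] by linarith
  qed
  then have "\<forall>x\<in>unit_cube.
      \<bar>p' x - p x - (\<Sum>l\<le>Suc j. a (q(i := l)) * multi_power x (q(i := l)))\<bar>
        \<le> (\<Sum>l\<le>Suc j. \<bar>a (q(i := l))\<bar>) * (real P * \<eta>)"
    by (simp add: S_def B_def q'_def)
  moreover have "affine_in w h' p'" unfolding p'_def using h' by (intro affine_in_intros)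
  moreover have "input_layer (n + (sum q UNIV + Suc j) * (2 * Suc m)) h'"
  proof -
    have "n + r * (2 * Suc m) + 2 * Suc m = n + (sum q UNIV + Suc j) * (2 * Suc m)"
      by (simp add: r_def)
    then show ?thesis using h'(1) by (simp only:)
  qed
  moreover have "\<forall>x\<in>unit_cube.
      \<bar>z x - multi_power x (q(i := Suc j))\<bar> \<le> real (sum q UNIV + Suc j) * \<eta>"
    using z unfolding r_def q'_def add_Suc_right .
  ultimately show ?case using h'(3)
    by - (rule exI[of _ h'], rule exI[of _ p'], rule exI[of _ z], intro conjI)
qed

section \<open>Summation over all chains\<close>

lemma finite_bounded_degree:
  "finite {q :: 'd::finite \<Rightarrow> nat. sum q UNIV \<le> P}"
proof (rule finite_subset)
  show "{q :: 'd \<Rightarrow> nat. sum q UNIV \<le> P} \<subseteq> PiE UNIV (\<lambda>_. {..P})"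
  proof
    fix q :: "'d \<Rightarrow> nat" assume "q \<in> {q. sum q UNIV \<le> P}"
    moreover have "q j \<le> sum q UNIV" for j by (rule member_le_sum) auto
    ultimately have "q j \<le> P" for j using order_trans by blast
    then show "q \<in> PiE UNIV (\<lambda>_. {..P})" by auto
  qed
qed (auto intro: finite_PiE)

text \<open>The chains run one after the other, each restarting from 1 while the sum is carried
  along. Stopping at exponent \<open>P - sum q UNIV\<close> makes every chain take exactly
  \<open>P\<close> multiplications, whatever the degree of \<open>q\<close>.\<close>

lemma ex_sum_of_chains:
  fixes a :: "('d::finite \<Rightarrow> nat) \<Rightarrow> real" and m :: nat and i :: 'd
  defines "w \<equiv> CARD('d) + 4" and "\<eta> \<equiv> 4 * (1 / 2) ^ Suc m"
  assumes small: "real P * \<eta> \<le> 1"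
    and "finite S" "S \<subseteq> {q. q i = 0 \<and> sum q UNIV \<le> P}"
  shows "\<exists>h p. input_layer (1 + card S * (P * (2 * Suc m))) h \<and> affine_in w h p \<and>
    (\<forall>x\<in>unit_cube.
      \<bar>p x - (\<Sum>q\<in>S. \<Sum>l\<le>P - sum q UNIV. a (q(i := l)) * multi_power x (q(i := l)))\<bar>
        \<le> (\<Sum>q\<in>S. \<Sum>l\<le>P - sum q UNIV. \<bar>a (q(i := l))\<bar>) * (real P * \<eta>))"
  using assms(4,5)
proof (induction S)
  case empty
  obtain h :: "nat \<Rightarrow> real ^ 'd \<Rightarrow> real" where "input_layer 1 h" using ex_first_input_layer by blast
  then show ?case using affine_in_const[of w h 0] by (intro exI[of _ h] exI[of _ "\<lambda>_. 0"]) auto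
next
  case (insert q S)
  define T where "T = (\<lambda>x. \<Sum>q\<in>S. \<Sum>l\<le>P - sum q UNIV. a (q(i := l)) * multi_power x (q(i := l)))"
  define B where "B = (\<Sum>q\<in>S. \<Sum>l\<le>P - sum q UNIV. \<bar>a (q(i := l))\<bar>)"
  define T' where "T' = (\<lambda>x. \<Sum>l\<le>P - sum q UNIV. a (q(i := l)) * multi_power x (q(i := l)))"
  define B' where "B' = (\<Sum>l\<le>P - sum q UNIV. \<bar>a (q(i := l))\<bar>)"
  have deg: "sum q UNIV + (P - sum q UNIV) = P" and q: "q i = 0" using insert.prems by auto
  have "S \<subseteq> {q. q i = 0 \<and> sum q UNIV \<le> P}" using insert.prems by blast
  from insert.IH[OF this] obtain h1 p1 where h1: "input_layer (1 + card S * (P * (2 * Suc m))) h1" "affine_in w h1 p1"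
    and p1: "\<forall>x\<in>unit_cube. \<bar>p1 x - T x\<bar> \<le> B * (real P * \<eta>)"
    unfolding T_def B_def by blast
  from ex_chain_layers[OF h1(1), folded w_def, OF h1(2) q eq_refl[OF deg] small[unfolded \<eta>_def],
      folded \<eta>_def, where a = a, unfolded deg]
  obtain h' p' where h': "input_layer (1 + card S * (P * (2 * Suc m)) + P * (2 * Suc m)) h'"
    "affine_in w h' p'"
    and p': "\<forall>x\<in>unit_cube. \<bar>p' x - p1 x - T' x\<bar> \<le> B' * (real P * \<eta>)"
    unfolding T'_def B'_def by blast
  have "\<bar>p' x - (T' x + T x)\<bar> \<le> (B' + B) * (real P * \<eta>)" if "x \<in> unit_cube" for x
    using bspec[OF p1 that] bspec[OF p' that] unfolding distrib_right by linarith
  then have "\<forall>x\<in>unit_cube.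
      \<bar>p' x - (\<Sum>q\<in>insert q S. \<Sum>l\<le>P - sum q UNIV. a (q(i := l)) * multi_power x (q(i := l)))\<bar>
        \<le> (\<Sum>q\<in>insert q S. \<Sum>l\<le>P - sum q UNIV. \<bar>a (q(i := l))\<bar>) * (real P * \<eta>)"
    unfolding sum.insert[OF insert.hyps] T_def B_def T'_def B'_def by blast
  moreover have "1 + card S * (P * (2 * Suc m)) + P * (2 * Suc m) = 1 + card (insert q S) * (P * (2 * Suc m))"
    using insert.hyps by simp
  from h'(1)[unfolded this] have "input_layer (1 + card (insert q S) * (P * (2 * Suc m))) h'" .
  ultimately show ?case using h'(2) by blast
qed

text \<open>Every \<open>k\<close> of degree at most \<open>P\<close> lies on exactly one chain:
  \<open>q\<close> is \<open>k\<close> with the entry at \<open>i\<close> set to 0, and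
  \<open>l\<close> is that entry.\<close>

lemma sum_bounded_degree_split:
  fixes g :: "('d::finite \<Rightarrow> nat) \<Rightarrow> real"
  shows "(\<Sum>k | sum k UNIV \<le> P. g k) =
    (\<Sum>q | q i = 0 \<and> sum q UNIV \<le> P. \<Sum>l\<le>P - sum q UNIV. g (q(i := l)))"
proof -
  have fin: "finite {q :: 'd \<Rightarrow> nat. q i = 0 \<and> sum q UNIV \<le> P}"
    by (rule finite_subset[OF _ finite_bounded_degree[of P]]) auto
  have "(\<Sum>q | q i = 0 \<and> sum q UNIV \<le> P. \<Sum>l\<le>P - sum q UNIV. g (q(i := l))) =
    (\<Sum>(q, l)\<in>Sigma {q. q i = 0 \<and> sum q UNIV \<le> P} (\<lambda>q. {..P - sum q UNIV}). g (q(i := l)))"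
    by (rule sum.Sigma) (use fin in auto)
  also have "\<dots> = (\<Sum>k | sum k UNIV \<le> P. g k)"
  proof (rule sum.reindex_bij_witness[where i = "\<lambda>k. (k(i := 0), k i)" and j = "\<lambda>(q, l). q(i := l)"])
    fix ql :: "('d \<Rightarrow> nat) \<times> nat"
    assume ql: "ql \<in> Sigma {q. q i = 0 \<and> sum q UNIV \<le> P} (\<lambda>q. {..P - sum q UNIV})"
    obtain q l where [simp]: "ql = (q, l)" by fastforce
    have q: "q i = 0" "sum q UNIV \<le> P" "l \<le> P - sum q UNIV" using ql by auto
    then show "(((case ql of (q, l) \<Rightarrow> q(i := l)))(i := 0), (case ql of (q, l) \<Rightarrow> q(i := l)) i) = ql"
      by (auto simp: fun_eq_iff)
    show "(case ql of (q, l) \<Rightarrow> q(i := l)) \<in> {k. sum k UNIV \<le> P}"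
      using q sum_fun_upd[of q i l] by simp
    show "g (case ql of (q, l) \<Rightarrow> q(i := l)) = (case ql of (q, l) \<Rightarrow> g (q(i := l)))"
      by simp
  next
    fix k :: "'d \<Rightarrow> nat"
    assume "k \<in> {k. sum k UNIV \<le> P}"
    then show "(k(i := 0), k i) \<in> Sigma {q. q i = 0 \<and> sum q UNIV \<le> P} (\<lambda>q. {..P - sum q UNIV})"
      using sum_fun_upd[of k i 0] by auto
    show "(case (k(i := 0), k i) of (q, l) \<Rightarrow> q(i := l)) = k" by simp
  qed
  finally show ?thesis by simp
qed

lemma ex_network_of_affine_in:
  fixes h :: "nat \<Rightarrow> real ^ 'd \<Rightarrow> real"
  assumes "input_layer n h" "affine_in (CARD('d) + 4) h p" "Suc n \<le> N"
  shows "\<exists>g. relu_network_function N (CARD('d) + 4) g \<and> (\<forall>x\<in>unit_cube. g x = p x)"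
proof -
  have "n \<le> N - 1" "N = Suc (N - 1)" using assms(3) by auto
  from ex_input_layer_pad[OF assms(1,2) this(1)] obtain h' where
    h': "hidden_layer (CARD('d) + 4) (N - 1) h'" "affine_in (CARD('d) + 4) h' p"
    unfolding input_layer_def by blast
  then obtain c b where "\<forall>x\<in>unit_cube. p x = (\<Sum>i<CARD('d) + 4. c i * h' i x) + b"
    unfolding affine_in_def by blast
  with h' \<open>N = Suc (N - 1)\<close> show ?thesis unfolding relu_network_function_def
    by (intro exI[of _ "\<lambda>x. (\<Sum>i<CARD('d) + 4. c i * h' i x) + b"]) auto
qed

section \<open>Number of chains and available depth\<close>

text \<open>A Chernoff bound: every \<open>q\<close> that is counted contributes at least \<open>t ^ P\<close> to a product of
  geometric sums.\<close>

lemma card_bounded_degree_le: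
  fixes i :: "'d::finite" and t :: real
  assumes t: "0 < t" "t < 1"
  shows "real (card {q :: 'd \<Rightarrow> nat. q i = 0 \<and> sum q UNIV \<le> P}) * t ^ P \<le> (1 / (1 - t)) ^ (CARD('d) - 1)"
proof -
  \<comment> \<open>Pinning coordinate \<open>i\<close> to 0 turns its factor into 1, which leaves
    one geometric sum for each of the other coordinates.\<close>
  define B where "B = (\<lambda>j. if j = i then {0} else {..P})"
  have sub: "{q. q i = 0 \<and> sum q UNIV \<le> P} \<subseteq> PiE UNIV B"
  proof
    fix q :: "'d \<Rightarrow> nat" assume "q \<in> {q. q i = 0 \<and> sum q UNIV \<le> P}"
    then have "q i = 0" "sum q UNIV \<le> P" by auto
    moreover have "q j \<le> sum q UNIV" for j by (rule member_le_sum) auto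
    ultimately have "q j \<le> P" for j using order_trans by blast
    then show "q \<in> PiE UNIV B" using \<open>q i = 0\<close> by (auto simp: B_def)
  qed
  have fin: "finite (PiE UNIV B)" by (intro finite_PiE) (auto simp: B_def)
  have "real (card {q :: 'd \<Rightarrow> nat. q i = 0 \<and> sum q UNIV \<le> P}) * t ^ P
      = (\<Sum>q | q i = 0 \<and> sum q UNIV \<le> P. t ^ P)" by simp
  also have "\<dots> \<le> (\<Sum>q | q i = 0 \<and> sum q UNIV \<le> P. t ^ sum q UNIV)"
    using t by (intro sum_mono power_decreasing) auto
  also have "\<dots> \<le> (\<Sum>q\<in>PiE UNIV B. t ^ sum q UNIV)"
    using t by (intro sum_mono2 fin sub) auto
  also have "\<dots> = (\<Sum>q\<in>PiE UNIV B. \<Prod>j\<in>UNIV. t ^ q j)" by (simp add: power_sum)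
  also have "\<dots> = (\<Prod>j\<in>UNIV. \<Sum>l\<in>B j. t ^ l)"
    by (rule prod_sum_PiE[symmetric]) (auto simp: B_def)
  also have "\<dots> = (\<Prod>j\<in>UNIV - {i}. \<Sum>l\<le>P. t ^ l)"
    by (subst prod.remove[of UNIV i]) (auto simp: B_def)
  also have "\<dots> = (\<Sum>l\<le>P. t ^ l) ^ (CARD('d) - 1)" by simp
  also have "\<dots> \<le> (1 / (1 - t)) ^ (CARD('d) - 1)"
  proof (rule power_mono)
    show "(\<Sum>l\<le>P. t ^ l) \<le> 1 / (1 - t)"
      using t by (simp add: sum_gp0 divide_right_mono)
    show "0 \<le> (\<Sum>l\<le>P. t ^ l)" using t by (intro sum_nonneg) auto
  qed
  finally show ?thesis .
qed

text \<open>These are the first three binomial terms; the induction step drops a nonnegative cubic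
  term. The bound serves to show that (1 + P/d)^d grows quadratically in \<open>P\<close> for d
  \<ge> 2.\<close>

lemma quadratic_le_power:
  fixes y :: real
  assumes "0 \<le> y"
  shows "1 + real n * y + real n * (real n - 1) / 2 * y\<^sup>2 \<le> (1 + y) ^ n"
proof (induction n)
  case (Suc n)
  have "0 \<le> real n * (real n - 1)" by (cases n) auto
  then have "0 \<le> real n * (real n - 1) / 2 * y ^ 3" using assms by simp
  then have "1 + real (Suc n) * y + real (Suc n) * (real (Suc n) - 1) / 2 * y\<^sup>2
      \<le> (1 + y) * (1 + real n * y + real n * (real n - 1) / 2 * y\<^sup>2)"
    by (simp add: field_simps power2_eq_square power3_eq_cube)
  also have "\<dots> \<le> (1 + y) * (1 + y) ^ n" using Suc assms by (intro mult_left_mono) auto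
  finally show ?case by simp
qed simp

text \<open>The 2 counts the first hidden layer and the output layer, and \<open>4 P + 8\<close> is
  the cost of a multiplication. For d \<ge> 2 the number of chains is at most
  \<open>E * R ^ (d - 1)\<close> and the layers per chain at most
  \<open>4 / 5 * E * R * R ^ d\<close>; the remaining fifth of the right side covers the 2. For d =
  1 there is a single chain, but \<open>R ^ d\<close> is only linear in \<open>P\<close>, so this
  case is separate.\<close>

lemma chains_fit_into_depth:
  fixes i :: "'d::finite" and P :: nat
  defines "d \<equiv> CARD('d)" and "C \<equiv> real (card {q :: 'd \<Rightarrow> nat. q i = 0 \<and> sum q UNIV \<le> P})"
  shows "2 + C * (real P * (4 * real P + 8)) \<le> (exp 1 * (real P / real d + 1)) ^ (2 * d)"
proof -
  define R where "R = 1 + real P / real d"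
  define E where "E = exp (real d)"
  have d: "0 < d" by (simp add: d_def)
  have R: "1 \<le> R" using d by (simp add: R_def)
  have goal_eq: "(exp 1 * (real P / real d + 1)) ^ (2 * d) = E\<^sup>2 * (R ^ d)\<^sup>2"
    by (simp add: E_def R_def power_mult_distrib power_mult[symmetric] exp_of_nat_mult[symmetric]
        mult.commute add.commute)
  have E: "1 + real d + (real d)\<^sup>2 / 2 \<le> E"
    unfolding E_def by (rule exp_lower_Taylor_quadratic) simp
  show ?thesis
  proof (cases "d = 1")
    case True
    then obtain j :: 'd where j: "(UNIV :: 'd set) = {j}" unfolding d_def by (metis card_1_singletonE)
    have "{q :: 'd \<Rightarrow> nat. q i = 0 \<and> sum q UNIV \<le> P} \<subseteq> {\<lambda>_. 0}"
    proof safe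
      fix q :: "'d \<Rightarrow> nat" assume "q i = 0"
      have "q x = 0" for x
      proof -
        have "x \<in> {j}" "i \<in> {j}" unfolding j[symmetric] by auto
        then show ?thesis using \<open>q i = 0\<close> by simp
      qed
      then show "q = (\<lambda>_. 0)" by blast
    qed
    then have "card {q :: 'd \<Rightarrow> nat. q i = 0 \<and> sum q UNIV \<le> P} \<le> card {\<lambda>_ :: 'd. 0 :: nat}"
      by (intro card_mono) auto
    then have "C \<le> 1" by (simp add: C_def)
    then have "C * (real P * (4 * real P + 8)) \<le> 1 * (real P * (4 * real P + 8))"
      by (intro mult_right_mono) auto
    moreover have "2 + real P * (4 * real P + 8) \<le> 2\<^sup>2 * (1 + real P)\<^sup>2"
      by (simp add: power2_eq_square algebra_simps)
    moreover have "2\<^sup>2 * (1 + real P)\<^sup>2 \<le> E\<^sup>2 * (R ^ d)\<^sup>2"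
      using E True by (intro mult_mono power_mono) (auto simp: R_def power2_eq_square)
    ultimately show ?thesis unfolding goal_eq by linarith
  next
    case False
    then have d2: "2 \<le> d" using d by linarith
    have E_lin: "5 / 2 * real d \<le> E"
    proof -
      \<comment> \<open>This turns the quadratic Taylor bound into a linear one, without loss at
        \<open>d = 2\<close>.\<close>
      have "0 \<le> (real d - 1) * (real d - 2)" using d2 by simp
      then show ?thesis using E by (simp add: power2_eq_square algebra_simps)
    qed
    then have E5: "5 \<le> E" using d2 by linarith
    have Rd1: "1 \<le> R ^ d" using R by simp
    have Rd: "(real P + 2)\<^sup>2 / 4 \<le> R ^ d"
    proof -
      have "(real P)\<^sup>2 * (1 / 4) \<le> (real P)\<^sup>2 * ((real d - 1) / (2 * real d))"
        using d2 by (intro mult_left_mono) (auto simp: field_simps)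
      also have "\<dots> = real d * (real d - 1) / 2 * (real P / real d)\<^sup>2"
        using d by (simp add: field_simps power2_eq_square)
      finally have "(real P)\<^sup>2 * (1 / 4) \<le> \<dots>" .
      moreover have "1 + real d * (real P / real d) + real d * (real d - 1) / 2 * (real P / real d)\<^sup>2 \<le> R ^ d"
        unfolding R_def by (rule quadratic_le_power) simp
      moreover have "real d * (real P / real d) = real P" using d by simp
      moreover have "(real P + 2)\<^sup>2 / 4 = (real P)\<^sup>2 * (1 / 4) + real P + 1"
        by (simp add: power2_eq_square field_simps)
      ultimately show ?thesis by linarith
    qed
    have "C * (real P * (4 * real P + 8)) \<le> 4 / 5 * (E\<^sup>2 * (R ^ d)\<^sup>2)"
    proof (cases "P = 0")
      case False
      \<comment> \<open>This \<open>t\<close> minimises t^(-P) (1 - t)^(-d). It makes 1 / (1 - t)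
        equal to \<open>R\<close>, while t^(-P) = (1 + d/P)^P stays below e^d.\<close>
      define t where "t = real P / (real P + real d)"
      have t: "0 < t" "t < 1" using False d by (auto simp: t_def)
      have R': "1 / (1 - t) = R" using False d by (simp add: t_def R_def field_simps)
      have "(1 / t) ^ P = (1 + real d / real P) ^ P" using False by (simp add: t_def field_simps)
      also have "\<dots> \<le> E" unfolding E_def using False by (intro exp_ge_one_plus_x_over_n_power_n) auto
      finally have tE: "(1 / t) ^ P \<le> E" .
      have "C * t ^ P \<le> R ^ (d - 1)"
        using card_bounded_degree_le[OF t, of i P] unfolding R' C_def d_def .
      then have "(1 / t) ^ P * (C * t ^ P) \<le> E * R ^ (d - 1)"
        using tE t E5 by (intro mult_mono) (auto simp: C_def)
      then have C: "C \<le> E * R ^ (d - 1)" using t by (simp add: power_divide)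
      \<comment> \<open>One factor is absorbed by the quadratic growth of \<open>R ^ d\<close>, the
        other by \<open>P + 2 \<le> P + d = d R\<close>, where d \<ge> 2 enters.\<close>
      have "8 * real P \<le> (real P + 2)\<^sup>2"
        using zero_le_power2[of "real P - 2"] by (simp add: power2_eq_square algebra_simps)
      then have "8 * real P * (real P + 2) \<le> (real P + 2)\<^sup>2 * (real P + real d)"
        using d2 by (intro mult_mono) auto
      moreover have "real d * R = real P + real d" using d by (simp add: R_def distrib_left)
      ultimately have "8 * real P * (real P + 2) \<le> (real P + 2)\<^sup>2 * (real d * R)" by simp
      then have "real P * (4 * real P + 8) \<le> 2 * real d * R * ((real P + 2)\<^sup>2 / 4)"
        by (simp add: algebra_simps)
      also have "\<dots> \<le> (4 / 5 * E) * R * R ^ d"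
        using E_lin E5 R by (intro mult_mono[OF mult_right_mono Rd]) auto
      finally have "C * (real P * (4 * real P + 8)) \<le> (E * R ^ (d - 1)) * ((4 / 5 * E) * R * R ^ d)"
        using R E5 by (intro mult_mono[OF C]) auto
      also have "\<dots> = 4 / 5 * (E * E * ((R ^ (d - 1) * R) * R ^ d))" by (simp only: ac_simps)
      also have "R ^ (d - 1) * R = R ^ d" using d by (rule power_minus_mult)
      finally show ?thesis by (simp add: power2_eq_square)
    qed simp
    moreover have "5\<^sup>2 * 1\<^sup>2 \<le> E\<^sup>2 * (R ^ d)\<^sup>2"
      using E5 Rd1 by (intro mult_mono power_mono) auto
    ultimately show ?thesis unfolding goal_eq by simp
  qed
qed

text \<open>Replacing e by 3 leaves an inequality between natural numbers. Its induction starts at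
  3, because \<open>3 * Suc P \<le> 4 * P\<close> needs \<open>P \<ge> 3\<close>.\<close>

lemma mult_exp_le_power_4: "real P * exp (real P + 1) \<le> 4 ^ Suc P"
proof -
  have "P * 3 ^ Suc P \<le> (4 :: nat) ^ Suc P"
  proof (cases "P \<le> 3")
    case True
    then consider "P = 0" | "P = 1" | "P = 2" | "P = 3" by linarith
    then show ?thesis by cases auto
  next
    case False
    then have "3 \<le> P" by simp
    then show ?thesis
    proof (induction P rule: dec_induct)
      case (step P)
      have "Suc P * 3 ^ Suc (Suc P) = (3 * Suc P) * 3 ^ Suc P"
        by (simp add: algebra_simps)
      also have "\<dots> \<le> (4 * P) * 3 ^ Suc P" using step.hyps by (intro mult_right_mono) auto
      also have "\<dots> \<le> 4 * 4 ^ Suc P" using step.IH by simp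
      finally show ?case by simp
    qed simp
  qed
  then have "real (P * 3 ^ Suc P) \<le> real (4 ^ Suc P)" by (rule of_nat_mono)
  then have "real P * 3 ^ Suc P \<le> 4 ^ Suc P"
    by (simp only: of_nat_mult of_nat_power of_nat_numeral)
  have "exp (real P + 1) \<le> 3 ^ Suc P"
  proof -
    have "exp (real P + 1) = exp 1 ^ Suc P" by (simp add: exp_of_nat_mult[symmetric] exp_add mult.commute)
    also have "\<dots> \<le> 3 ^ Suc P" by (intro power_mono exp_le) auto
    finally show ?thesis .
  qed
  then have "real P * exp (real P + 1) \<le> real P * 3 ^ Suc P" by (rule mult_left_mono) simp
  also have "\<dots> \<le> 4 ^ Suc P" by fact
  finally show ?thesis .
qed

section \<open>Truncation of the series and assembly of the network\<close>

text \<open>The depth is \<open>L\<close> rounded down, and \<open>L_ge\<close> ensures that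
  networks of this depth exist. A nonzero coefficient makes the right side of the strict inequality
  positive.\<close>

theorem corollary11:
  fixes f :: "real ^ 'd \<Rightarrow> real"
    and a :: "('d \<Rightarrow> nat) \<Rightarrow> real"
    and \<epsilon> \<delta> L :: real
  assumes abs_conv: "\<And>x. (\<forall>i. x $ i \<in> {-1..1}) \<Longrightarrow>
                       (\<lambda>k. \<bar>a k * multi_power x k\<bar>) summable_on UNIV"
    and f_eq: "\<And>x. (\<forall>i. x $ i \<in> {-1..1}) \<Longrightarrow> f x = (\<Sum>\<^sub>\<infinity>k. a k * multi_power x k)"
    and nonzero: "\<exists>k. a k \<noteq> 0"
    and "0 < \<epsilon>" and "0 < \<delta>"
    and L: "L = (exp 1 * (1 / (real CARD('d) * \<delta>) * ln (1 / \<epsilon>) + 1)) ^ (2 * CARD('d))"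
    and L_ge: "2 \<le> L"
  shows "\<exists>g :: real ^ 'd \<Rightarrow> real.
           relu_network_function (nat \<lfloor>L\<rfloor>) (CARD('d) + 4) g \<and>
           (\<forall>x. (\<forall>i. x $ i \<in> {-1 + \<delta>..1 - \<delta>}) \<longrightarrow> \<bar>f x - g x\<bar> < 2 * \<epsilon> * (\<Sum>\<^sub>\<infinity>k. \<bar>a k\<bar>))"
proof -
  define d where "d = CARD('d)"
  define F where "F = (\<lambda>k. \<bar>a k\<bar>)"
  have N: "Suc 1 \<le> nat \<lfloor>L\<rfloor>" using L_ge by linarith
  have cube_iff: "x \<in> unit_cube \<longleftrightarrow> (\<forall>i. x $ i \<in> {-1..1})" for x :: "real ^ 'd"
    by (simp add: unit_cube_def abs_le_iff minus_le_iff conj_commute)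
  \<comment> \<open>At the corner (1, ..., 1) every monomial equals 1.\<close>
  have F_sum: "F summable_on UNIV"
    using abs_conv[of "\<chi> i. 1"] by (simp add: multi_power_def F_def)
  have F_pos: "0 < infsum F UNIV"
  proof -
    obtain k where "a k \<noteq> 0" using nonzero by blast
    then have "0 < sum F {k}" by (simp add: F_def)
    also have "\<dots> \<le> infsum F UNIV"
      using F_sum by (intro finite_sum_le_infsum) (auto simp: F_def)
    finally show ?thesis .
  qed
  have term_sum: "(\<lambda>k. \<bar>a k * multi_power x k\<bar>) summable_on S"
    if "x \<in> unit_cube" for x :: "real ^ 'd" and S
  proof -
    have "\<forall>i. x $ i \<in> {-1..1}" using that unfolding cube_iff .
    from summable_on_subset_banach[OF abs_conv[OF this] subset_UNIV] show ?thesis .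
  qed
  \<comment> \<open>Used with \<rho> = 1 on all terms and with \<rho> = \<epsilon> on the
    tail.\<close>
  have f_bound: "\<bar>infsum (\<lambda>k. a k * multi_power x k) S\<bar> \<le> \<rho> * infsum F S"
    if x: "x \<in> unit_cube" and le: "\<And>k. k \<in> S \<Longrightarrow> \<bar>multi_power x k\<bar> \<le> \<rho>"
    for x :: "real ^ 'd" and S and \<rho> :: real
  proof -
    have "\<bar>infsum (\<lambda>k. a k * multi_power x k) S\<bar> \<le> infsum (\<lambda>k. \<bar>a k * multi_power x k\<bar>) S"
      using norm_infsum_bound[of "\<lambda>k. a k * multi_power x k" S] term_sum[OF x] by simp
    also have "\<dots> \<le> infsum (\<lambda>k. \<rho> * F k) S"
    proof (rule infsum_mono[OF term_sum[OF x]])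
      show "(\<lambda>k. \<rho> * F k) summable_on S"
        by (intro summable_on_cmult_right summable_on_subset_banach[OF F_sum]) simp
      show "\<bar>a k * multi_power x k\<bar> \<le> \<rho> * F k" if "k \<in> S" for k
        using mult_left_mono[OF le[OF that], of "\<bar>a k\<bar>"] by (simp add: F_def abs_mult mult.commute)
    qed
    also have "\<dots> = \<rho> * infsum F S"
      by (rule infsum_cmult_right) (rule summable_on_subset_banach[OF F_sum subset_UNIV])
    finally show ?thesis .
  qed
  show ?thesis
  proof (cases "\<epsilon> \<le> 1 \<and> \<delta> \<le> 1")
    \<comment> \<open>If \<delta> > 1, the smaller cube is empty; otherwise \<epsilon> > 1, and the
      zero function is close enough.\<close>
    case False
    obtain h :: "nat \<Rightarrow> real ^ 'd \<Rightarrow> real" where "input_layer 1 h" using ex_first_input_layer by blast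
    from ex_network_of_affine_in[OF this affine_in_const[of _ _ 0] N]
    obtain g :: "real ^ 'd \<Rightarrow> real" where g: "relu_network_function (nat \<lfloor>L\<rfloor>) (CARD('d) + 4) g"
      "\<forall>x\<in>unit_cube. g x = 0" by blast
    have "\<bar>f x - g x\<bar> < 2 * \<epsilon> * infsum F UNIV" if box: "\<forall>i. x $ i \<in> {-1 + \<delta>..1 - \<delta>}" for x
    proof -
      fix i :: 'd
      have "\<delta> \<le> 1" using spec[OF box, of i] by simp
      then have "1 < 2 * \<epsilon>" using False by linarith
      have "\<forall>i. x $ i \<in> {-1..1}" using box \<open>0 < \<delta>\<close> by (smt (verit) atLeastAtMost_iff)
      then have x: "x \<in> unit_cube" and "f x = (\<Sum>\<^sub>\<infinity>k. a k * multi_power x k)"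
        using cube_iff f_eq by blast+
      then have "\<bar>f x - g x\<bar> \<le> 1 * infsum F UNIV"
        using f_bound[OF x, of UNIV 1] abs_multi_power_le_1[OF x] g(2) by simp
      also have "\<dots> < 2 * \<epsilon> * infsum F UNIV"
        using \<open>1 < 2 * \<epsilon>\<close> F_pos by (intro mult_strict_right_mono)
      finally show ?thesis .
    qed
    then show ?thesis using g(1) unfolding F_def by blast
  next
    case True
    then have eps: "\<epsilon> \<le> 1" "\<delta> \<le> 1" by auto
    \<comment> \<open>A decay by exp(-\<delta>) per degree reaches \<epsilon> at degree
      \<open>M\<close>. Rounding down serves both sides: \<open>P \<le> M\<close> keeps the depth
      below \<open>L\<close>, and \<open>M \<le> P + 1\<close> makes the omitted terms
      small.\<close>
    define M where "M = ln (1 / \<epsilon>) / \<delta>"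
    define P where "P = nat \<lfloor>M\<rfloor>"
    \<comment> \<open>Then \<open>\<eta>\<close> is exactly 4^(-(P + 1)).\<close>
    define m where "m = 2 * P + 3"
    define \<eta> :: real where "\<eta> = 4 * (1 / 2) ^ Suc m"
    \<comment> \<open>Any coordinate may serve as the direction of the chains.\<close>
    fix i :: 'd
    define S where "S = {q. q i = 0 \<and> sum q UNIV \<le> P}"
    define K where "K = {k :: 'd \<Rightarrow> nat. sum k UNIV \<le> P}"
    have "0 \<le> M" using eps \<open>0 < \<epsilon>\<close> \<open>0 < \<delta>\<close> by (simp add: M_def)
    then have P: "real P \<le> M" "M \<le> real P + 1" unfolding P_def by linarith+
    have eps_eq: "\<epsilon> = exp (- (\<delta> * M))"
      using \<open>0 < \<epsilon>\<close> \<open>0 < \<delta>\<close> by (simp add: M_def ln_div)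
    have "\<delta> * M \<le> 1 * (real P + 1)"
      using eps P \<open>0 \<le> M\<close> \<open>0 < \<delta>\<close> by (intro mult_mono) auto
    then have "exp (- (real P + 1)) \<le> \<epsilon>" unfolding eps_eq by simp
    moreover have "real P * \<eta> \<le> exp (- (real P + 1))"
    proof -
      have "\<eta> = 4 * (1 / 2) ^ (2 * (P + 2))" unfolding \<eta>_def m_def
        by (simp add: power_add power_divide)
      also have "\<dots> = 1 / 4 ^ Suc P"
        unfolding power_mult by (simp add: power2_eq_square power_divide)
      finally have "real P * \<eta> = (real P * exp (real P + 1)) / 4 ^ Suc P * exp (- (real P + 1))"
        by (simp only: exp_minus) simp
      also have "\<dots> \<le> 1 * exp (- (real P + 1))"
        using mult_exp_le_power_4[of P] by (intro mult_right_mono) auto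
      finally show ?thesis by simp
    qed
    ultimately have small: "real P * \<eta> \<le> \<epsilon>" by linarith
    have "finite S" unfolding S_def
      by (rule finite_subset[OF _ finite_bounded_degree[of P]]) auto
    from ex_sum_of_chains[where a = a, OF order_trans[OF small eps(1), unfolded \<eta>_def] this, folded \<eta>_def]
    obtain h p where h: "input_layer (1 + card S * (P * (2 * Suc m))) h" "affine_in (CARD('d) + 4) h p"
      and p: "\<forall>x\<in>unit_cube. \<bar>p x - (\<Sum>k\<in>K. a k * multi_power x k)\<bar> \<le> sum F K * (real P * \<eta>)"
      unfolding K_def sum_bounded_degree_split[of _ P i] F_def S_def by blast
    have "real (Suc (1 + card S * (P * (2 * Suc m)))) = 2 + real (card S) * (real P * (4 * real P + 8))"
      by (simp add: m_def)
    also have "\<dots> \<le> (exp 1 * (real P / real d + 1)) ^ (2 * d)"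
      using chains_fit_into_depth[of i P] unfolding S_def d_def .
    also have "\<dots> \<le> (exp 1 * (M / real d + 1)) ^ (2 * d)"
      using P(1) by (intro power_mono mult_left_mono add_right_mono divide_right_mono) auto
    also have "\<dots> = L" unfolding L M_def d_def by (simp add: mult.commute)
    finally have "Suc (1 + card S * (P * (2 * Suc m))) \<le> nat \<lfloor>L\<rfloor>" by (simp add: le_nat_floor)
    from ex_network_of_affine_in[OF h this] obtain g where
      g: "relu_network_function (nat \<lfloor>L\<rfloor>) (CARD('d) + 4) g" "\<forall>x\<in>unit_cube. g x = p x" by blast
    have "\<bar>f x - g x\<bar> < 2 * \<epsilon> * infsum F UNIV" if box: "\<forall>i. x $ i \<in> {-1 + \<delta>..1 - \<delta>}" for x
    proof -
      have "\<forall>i. x $ i \<in> {-1..1}" using box \<open>0 < \<delta>\<close> by (smt (verit) atLeastAtMost_iff)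
      then have x: "x \<in> unit_cube" and f: "f x = infsum (\<lambda>k. a k * multi_power x k) UNIV"
        using cube_iff f_eq by blast+
      \<comment> \<open>Outside \<open>K\<close> the degree is at least \<open>P + 1\<close>, hence
        at least \<open>M\<close>, and 1 - \<delta> \<le> exp(-\<delta>).\<close>
      have tail: "\<bar>multi_power x k\<bar> \<le> \<epsilon>" if "k \<in> - K" for k
      proof -
        have k: "real P + 1 \<le> real (sum k UNIV)"
          using that unfolding K_def Compl_iff mem_Collect_eq by linarith
        have "\<bar>x $ i\<bar> \<le> 1 - \<delta>" for i using spec[OF box, of i] by (simp add: abs_le_iff)
        then have "\<bar>multi_power x k\<bar> \<le> (1 - \<delta>) ^ sum k UNIV" by (rule abs_multi_power_le)
        also have "\<dots> \<le> exp (- \<delta>) ^ sum k UNIV"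
          using exp_ge_add_one_self[of "- \<delta>"] eps by (intro power_mono) auto
        also have "\<dots> = exp (- (\<delta> * real (sum k UNIV)))"
          using exp_of_nat_mult[of "sum k UNIV" "- \<delta>"] by (simp only: mult_minus_right mult_minus_left mult.commute)
        also have "\<dots> \<le> \<epsilon>" unfolding eps_eq using P(2) k \<open>0 < \<delta>\<close> by simp
        finally show ?thesis .
      qed
      have split: "infsum G UNIV = sum G K + infsum G (- K)" if "G summable_on UNIV"
        for G :: "('d \<Rightarrow> nat) \<Rightarrow> real"
      proof -
        have "infsum G (K \<union> - K) = infsum G K + infsum G (- K)"
          using that by (intro infsum_Un_disjoint summable_on_subset_banach[OF that]) auto
        moreover have "finite K" unfolding K_def by (rule finite_bounded_degree)
        ultimately show ?thesis by simp
      qed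
      have "(\<lambda>k. a k * multi_power x k) summable_on UNIV"
        by (rule abs_summable_summable) (use term_sum[OF x, of UNIV] in simp)
      note f_split = f[unfolded split[OF this]]
      \<comment> \<open>The network error on \<open>K\<close> and the tail error are each at most
        \<epsilon> times their own share of the coefficients. Together they give \<epsilon> times
        the full sum; the factor 2 provides strictness.\<close>
      have "\<bar>f x - g x\<bar> \<le> sum F K * (real P * \<eta>) + \<epsilon> * infsum F (- K)"
      proof -
        have "\<bar>infsum (\<lambda>k. a k * multi_power x k) (- K)\<bar> \<le> \<epsilon> * infsum F (- K)"
          by (rule f_bound[OF x tail])
        moreover have "\<bar>p x - (\<Sum>k\<in>K. a k * multi_power x k)\<bar> \<le> sum F K * (real P * \<eta>)" "g x = p x"
          using p g(2) x by auto
        ultimately show ?thesis unfolding f_split by linarith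
      qed
      also have "\<dots> \<le> sum F K * \<epsilon> + \<epsilon> * infsum F (- K)"
        using small by (intro add_right_mono mult_left_mono) (auto simp: F_def intro: sum_nonneg)
      also have "\<dots> = \<epsilon> * infsum F UNIV" unfolding split[OF F_sum] by (simp add: algebra_simps)
      also have "\<dots> < 2 * \<epsilon> * infsum F UNIV" using F_pos \<open>0 < \<epsilon>\<close> by simp
      finally show ?thesis .
    qed
    then show ?thesis using g(1) unfolding F_def by blast
  qed
qed

end
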